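(* The ai-semiring $R_6$ is nonfinitely based.
   Context: An additively idempotent semiring (ai-semiring) is an algebra $(S,+,\cdot)$ with two binary operations (no constants in the signature) such that $(S,+)$ is a commutative idempotent semigroup, $(S,\cdot)$ is a semigroup, and $x(y+z)\approx xy+xz$ and $(x+y)z\approx xz+yz$ hold. Let $X$ be a countably infinite set of variables. A term is a finite nonempty set of words of the free semigroup $X^+$, written as a formal sum of its elements; an identity is a formal expression $\mathbf{u}\approx\mathbf{v}$ with $\mathbf{u},\mathbf{v}$ terms; it holds in $S$ if both sides take the same value in $S$ under every assignment of elements of $S$ to the variables. A variety of ai-semirings is a class of ai-semirings closed under subalgebras, homomorphic images and arbitrary direct products (equivalently, the class of all ai-semirings satisfying some set of identities). A variety is finitely based if it can be defined, within ai-semirings, by a finite set of identities; otherwise it is nonfinitely based. An ai-semiring $S$ is nonfinitely based if the variety $\mathsf{V}(S)$ it generates is nonfinitely based. $R_6=\{1,2,3,4,5,6\}$ is the ai-semiring with Cayley tables $$\begin{array}{c|cccccc} + &1&2&3&4&5&6\\ \hline 1&1&2&1&1&2&1\\ 2&2&2&2&2&2&2\\ 3&1&2&3&1&2&1\\ 4&1&2&1&4&2&1\\ 5&2&2&2&2&5&2\\ 6&1&2&1&1&2&6\end{array}\qquad \begin{array}{c|cccccc} \cdot &1&2&3&4&5&6\\ \hline 1&2&2&1&2&2&2\\ 2&2&2&2&2&2&2\\ 3&1&2&3&4&2&1\\ 4&2&2&4&2&2&2\\ 5&2&2&2&2&2&2\\ 6&2&2&1&2&2&5\end{array}$$ *)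

theory Defs
  imports Main
begin

record 'a alg =
  carrier :: "'a set"
  add :: "'a \<Rightarrow> 'a \<Rightarrow> 'a"
  mul :: "'a \<Rightarrow> 'a \<Rightarrow> 'a"

definition ai_semiring :: "'a alg \<Rightarrow> bool" where
  "ai_semiring S \<longleftrightarrow>
     carrier S \<noteq> {} \<and>
     (\<forall>x\<in>carrier S. \<forall>y\<in>carrier S. add S x y \<in> carrier S \<and> mul S x y \<in> carrier S) \<and>
     (\<forall>x\<in>carrier S. add S x x = x) \<and>
     (\<forall>x\<in>carrier S. \<forall>y\<in>carrier S. add S x y = add S y x) \<and>
     (\<forall>x\<in>carrier S. \<forall>y\<in>carrier S. \<forall>z\<in>carrier S.
        add S (add S x y) z = add S x (add S y z) \<and>
        mul S (mul S x y) z = mul S x (mul S y z) \<and>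
        mul S x (add S y z) = add S (mul S x y) (mul S x z) \<and>
        mul S (add S x y) z = add S (mul S x z) (mul S y z))"

text \<open>The variables are the natural numbers; a word is a nonempty list of variables.\<close>

type_synonym trm = "nat list set"

definition terms :: "trm set" where
  "terms = {T. finite T \<and> T \<noteq> {} \<and> [] \<notin> T}"

definition identities :: "(trm \<times> trm) set" where
  "identities = terms \<times> terms"

text \<open>Iterated binary operation on nonempty lists; the signature has no constants, so the value
  on the empty list is left unspecified.\<close>

fun fold1 :: "('a \<Rightarrow> 'a \<Rightarrow> 'a) \<Rightarrow> 'a list \<Rightarrow> 'a" where
  "fold1 f [] = undefined"
| "fold1 f [x] = x"
| "fold1 f (x # y # zs) = f x (fold1 f (y # zs))"

definition word_val :: "'a alg \<Rightarrow> (nat \<Rightarrow> 'a) \<Rightarrow> nat list \<Rightarrow> 'a" where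
  "word_val S h w = fold1 (mul S) (map h w)"

text \<open>In an ai-semiring the choice of the enumeration does not matter; see
  \<open>term_val_set\<close> below.\<close>

definition term_val :: "'a alg \<Rightarrow> (nat \<Rightarrow> 'a) \<Rightarrow> trm \<Rightarrow> 'a" where
  "term_val S h T = fold1 (add S) (map (word_val S h) (SOME ws. distinct ws \<and> set ws = T))"

definition satisfies :: "'a alg \<Rightarrow> trm \<times> trm \<Rightarrow> bool" where
  "satisfies S e \<longleftrightarrow>
     (\<forall>h. (\<forall>i. h i \<in> carrier S) \<longrightarrow> term_val S h (fst e) = term_val S h (snd e))"

definition models :: "(trm \<times> trm) set \<Rightarrow> 'a alg set" where
  "models E = {A. ai_semiring A \<and> (\<forall>e\<in>E. satisfies A e)}"

text \<open>Varieties are taken as equational classes, and the variety generated by \<open>S\<close> is the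
  intersection of all varieties containing \<open>S\<close>. A class consists of ai-semirings whose carriers
  are subsets of a universe \<open>'u\<close>, which need not be the type of the elements of \<open>S\<close>. Since an
  identity that fails in an algebra fails in a countable subalgebra of it, any infinite universe
  suffices to tell apart different varieties, and whether a variety is finitely based does not
  depend on which infinite universe is used.\<close>

definition generated_variety :: "'a alg \<Rightarrow> 'u alg set" where
  "generated_variety S = \<Inter> {models E | E. E \<subseteq> identities \<and> S \<in> models E}"

definition finitely_based :: "'u alg set \<Rightarrow> bool" where
  "finitely_based K \<longleftrightarrow> (\<exists>E. finite E \<and> E \<subseteq> identities \<and> K = models E)"

definition R6 :: "nat alg" where
  "R6 = \<lparr>
     carrier = {1, 2, 3, 4, 5, 6},
     add = (\<lambda>x y.
       [[1, 2, 1, 1, 2, 1],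
        [2, 2, 2, 2, 2, 2],
        [1, 2, 3, 1, 2, 1],
        [1, 2, 1, 4, 2, 1],
        [2, 2, 2, 2, 5, 2],
        [1, 2, 1, 1, 2, 6]] ! (x - 1) ! (y - 1)),
     mul = (\<lambda>x y.
       [[2, 2, 1, 2, 2, 2],
        [2, 2, 2, 2, 2, 2],
        [1, 2, 3, 4, 2, 1],
        [2, 2, 4, 2, 2, 2],
        [2, 2, 2, 2, 2, 2],
        [2, 2, 1, 2, 2, 5]] ! (x - 1) ! (y - 1))\<rparr>"

lemma ai_semiring_R6: "ai_semiring R6"
  unfolding ai_semiring_def R6_def by code_simp

lemma fold1_Cons: "xs \<noteq> [] \<Longrightarrow> fold1 f (x # xs) = f x (fold1 f xs)"
  by (cases xs) auto

lemma fold1_closed: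
  assumes "\<And>x y. x \<in> C \<Longrightarrow> y \<in> C \<Longrightarrow> f x y \<in> C" "xs \<noteq> []" "set xs \<subseteq> C"
  shows "fold1 f xs \<in> C"
  using assms(2,3)
proof (induction xs)
  case (Cons x xs)
  then show ?case using assms(1) by (cases "xs = []") (auto simp: fold1_Cons)
qed simp

lemma word_val_closed:
  assumes "ai_semiring S" "\<And>i. h i \<in> carrier S" "w \<noteq> []"
  shows "word_val S h w \<in> carrier S"
  unfolding word_val_def using assms by (intro fold1_closed) (auto simp: ai_semiring_def)

lemma fold1_upper:
  assumes S: "ai_semiring S" and xs: "set xs \<subseteq> carrier S" and x: "x \<in> set xs"
  shows "add S x (fold1 (add S) xs) = fold1 (add S) xs"
  using xs x
proof (induction xs)
  case (Cons y xs)
  show ?case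
  proof (cases "xs = []")
    case True
    then show ?thesis using Cons.prems S by (auto simp: ai_semiring_def)
  next
    case False
    let ?s = "fold1 (add S) xs"
    have s: "?s \<in> carrier S"
      using False Cons.prems S by (intro fold1_closed) (auto simp: ai_semiring_def)
    have y: "y \<in> carrier S" and xc: "x \<in> carrier S" using Cons.prems by auto
    have assoc: "add S (add S a b) c = add S a (add S b c)"
      and comm: "add S a b = add S b a" and idem: "add S a a = a"
      if "a \<in> carrier S" "b \<in> carrier S" "c \<in> carrier S" for a b c
      using that S by (auto simp: ai_semiring_def)
    show ?thesis
    proof (cases "x = y")
      case True
      then show ?thesis using False assoc[OF y y s] idem[OF y y y] by (simp add: fold1_Cons)
    next
      case neq: False
      then have "add S x ?s = ?s" using Cons by auto
      then show ?thesis
        using False assoc[OF xc y s] assoc[OF y xc s] comm[OF xc y s] by (simp add: fold1_Cons)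
    qed
  qed
qed simp

lemma fold1_least:
  assumes S: "ai_semiring S" and xs: "set xs \<subseteq> carrier S" "xs \<noteq> []" and z: "z \<in> carrier S"
    and "\<And>x. x \<in> set xs \<Longrightarrow> add S x z = z"
  shows "add S (fold1 (add S) xs) z = z"
  using xs assms(5)
proof (induction xs)
  case (Cons y xs)
  show ?case
  proof (cases "xs = []")
    case False
    then have s: "fold1 (add S) xs \<in> carrier S"
      using Cons.prems S by (intro fold1_closed) (auto simp: ai_semiring_def)
    have "add S (fold1 (add S) xs) z = z" using Cons False by auto
    moreover have "add S y z = z" "y \<in> carrier S" using Cons.prems by auto
    ultimately show ?thesis using s z S False by (auto simp: fold1_Cons ai_semiring_def)
  qed (use Cons.prems in simp)
qed simp

lemma fold1_add_cong:
  assumes S: "ai_semiring S" and xs: "set xs \<subseteq> carrier S" "xs \<noteq> []" and eq: "set xs = set ys"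
  shows "fold1 (add S) xs = fold1 (add S) ys"
proof -
  have ys: "set ys \<subseteq> carrier S" "ys \<noteq> []" using xs eq by auto
  have c: "fold1 (add S) xs \<in> carrier S" "fold1 (add S) ys \<in> carrier S"
    using xs ys S by (auto intro!: fold1_closed simp: ai_semiring_def)
  have "add S (fold1 (add S) xs) (fold1 (add S) ys) = fold1 (add S) ys"
    using fold1_least[OF S xs c(2)] fold1_upper[OF S ys(1)] eq by auto
  moreover have "add S (fold1 (add S) ys) (fold1 (add S) xs) = fold1 (add S) xs"
    using fold1_least[OF S ys c(1)] fold1_upper[OF S xs(1)] eq by auto
  ultimately show ?thesis using c S by (auto simp: ai_semiring_def)
qed

lemma term_val_set:
  assumes "ai_semiring S" "\<And>i. h i \<in> carrier S" "ws \<noteq> []" "[] \<notin> set ws"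
  shows "term_val S h (set ws) = fold1 (add S) (map (word_val S h) ws)"
proof -
  let ?vs = "SOME vs. distinct vs \<and> set vs = set ws"
  have "\<exists>vs. distinct vs \<and> set vs = set ws"
    using finite_distinct_list[of "set ws"] by auto
  then have vs: "set ?vs = set ws" by (metis (mono_tags, lifting) someI_ex)
  have "word_val S h w \<in> carrier S" if "w \<in> set ws" for w
    using assms that by (intro word_val_closed) auto
  then have "fold1 (add S) (map (word_val S h) ws) = fold1 (add S) (map (word_val S h) ?vs)"
    using assms(1,3) by (intro fold1_add_cong) (auto simp: vs)
  then show ?thesis by (simp add: term_val_def)
qed

end

(* Let u be the sum of the words x_i x_(i+1) along a cycle of odd length n, together with y and yz.
   R6 satisfies u = u + x_0: a bound on a product in R6 also bounds its factors, unless it is 4 or 5;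
   the summands y and yz keep u from taking the value 5, and if u took the value 4, then the values
   3 and 4 would colour the odd cycle properly. Every proper part of the cycle, however, has two
   opposite 2-colourings, so no identity of R6 in fewer than n variables can add a letter x_i to a
   sum contained in u. Hence the syntactic ai-semiring of the set of words of u (up to commutativity)
   satisfies all these identities, but not u = u + x_0. *)

theory Submission
  imports Defs
begin

section \<open>Term values and isomorphic copies\<close>

text \<open>The value is defined through an enumeration picked by \<open>SOME\<close>; fixing one
  concrete enumeration here lets the list lemmas about \<open>fold1\<close> apply.\<close>

lemma term_enumeration:
  assumes "ai_semiring S" "\<And>i. h i \<in> carrier S" "T \<in> terms"
  obtains ws where "set ws = T" "ws \<noteq> []" "[] \<notin> set ws"
    "term_val S h T = fold1 (add S) (map (word_val S h) ws)"
    "set (map (word_val S h) ws) \<subseteq> carrier S"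
proof -
  obtain ws where ws: "set ws = T" using assms(3) finite_list by (auto simp: terms_def)
  have ne: "ws \<noteq> []" "[] \<notin> set ws" using ws assms(3) by (auto simp: terms_def)
  have "word_val S h w \<in> carrier S" if "w \<in> set ws" for w
    using word_val_closed[of S h w] assms(1,2) ne(2) that by blast
  then show ?thesis
    using that[of ws] term_val_set[OF assms(1,2) ne] ws ne by auto
qed

lemma term_val_closed:
  assumes "ai_semiring S" "\<And>i. h i \<in> carrier S" "T \<in> terms"
  shows "term_val S h T \<in> carrier S"
proof (rule term_enumeration[of S h T])
  fix ws assume "ws \<noteq> []" "set (map (word_val S h) ws) \<subseteq> carrier S"
    and "term_val S h T = fold1 (add S) (map (word_val S h) ws)"
  then show ?thesis
    using assms(1) fold1_closed[of "carrier S" "add S" "map (word_val S h) ws"]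
    by (simp add: ai_semiring_def)
qed (use assms in auto)

text \<open>In the order where \<open>x\<close> lies below \<open>z\<close> iff
  \<open>add S x z = z\<close>, this and \<open>term_val_least\<close> make the value of a term the
  supremum of the values of its words. Most arguments below use only this.\<close>

lemma term_val_upper:
  assumes "ai_semiring S" "\<And>i. h i \<in> carrier S" "T \<in> terms" "w \<in> T"
  shows "add S (word_val S h w) (term_val S h T) = term_val S h T"
proof (rule term_enumeration[of S h T])
  fix ws assume "set ws = T" "set (map (word_val S h) ws) \<subseteq> carrier S"
    and "term_val S h T = fold1 (add S) (map (word_val S h) ws)"
  then show ?thesis
    using assms(1,4) fold1_upper[of S "map (word_val S h) ws" "word_val S h w"] by simp
qed (use assms in auto)

lemma term_val_least:
  assumes "ai_semiring S" "\<And>i. h i \<in> carrier S" "T \<in> terms" "z \<in> carrier S"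
    and "\<And>w. w \<in> T \<Longrightarrow> add S (word_val S h w) z = z"
  shows "add S (term_val S h T) z = z"
proof (rule term_enumeration[of S h T])
  fix ws assume "set ws = T" "ws \<noteq> []" "set (map (word_val S h) ws) \<subseteq> carrier S"
    and "term_val S h T = fold1 (add S) (map (word_val S h) ws)"
  then show ?thesis
    using fold1_least[of S "map (word_val S h) ws" z] assms(1,4,5) by auto
qed (use assms in auto)

section \<open>Transporting an algebra into another universe along an injection\<close>

definition copy :: "('a \<Rightarrow> 'b) \<Rightarrow> 'a alg \<Rightarrow> 'b alg" where
  "copy f S = \<lparr>carrier = f ` carrier S,
     add = (\<lambda>x y. f (add S (inv_into (carrier S) f x) (inv_into (carrier S) f y))),
     mul = (\<lambda>x y. f (mul S (inv_into (carrier S) f x) (inv_into (carrier S) f y)))\<rparr>"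

lemma copy_simps:
  assumes "inj_on f (carrier S)"
  shows "carrier (copy f S) = f ` carrier S"
    and "x \<in> carrier S \<Longrightarrow> y \<in> carrier S \<Longrightarrow> add (copy f S) (f x) (f y) = f (add S x y)"
    and "x \<in> carrier S \<Longrightarrow> y \<in> carrier S \<Longrightarrow> mul (copy f S) (f x) (f y) = f (mul S x y)"
  using assms by (auto simp: copy_def)

lemma ai_semiring_copy:
  assumes "inj_on f (carrier S)" "ai_semiring S"
  shows "ai_semiring (copy f S)"
proof -
  note copy = copy_simps[OF assms(1)]
  have closed: "add S x y \<in> carrier S" "mul S x y \<in> carrier S"
    if "x \<in> carrier S" "y \<in> carrier S" for x y
    using assms(2) that by (auto simp: ai_semiring_def)
  have comm: "add S x y = add S y x" if "x \<in> carrier S" "y \<in> carrier S" for x y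
    using assms(2) that unfolding ai_semiring_def by blast
  have laws: "add S (add S x y) z = add S x (add S y z)"
    "mul S (mul S x y) z = mul S x (mul S y z)"
    "mul S x (add S y z) = add S (mul S x y) (mul S x z)"
    "mul S (add S x y) z = add S (mul S x z) (mul S y z)"
    if "x \<in> carrier S" "y \<in> carrier S" "z \<in> carrier S" for x y z
    using assms(2) that unfolding ai_semiring_def by blast+
  have "carrier S \<noteq> {}" "\<forall>x\<in>carrier S. add S x x = x"
    using assms(2) unfolding ai_semiring_def by blast+
  then show ?thesis
    unfolding ai_semiring_def copy(1) ball_simps
    by (intro conjI ballI) (simp_all add: copy(2,3) closed laws comm[THEN arg_cong, of _ _ f])
qed

lemma fold1_map:
  assumes "\<And>x y. x \<in> C \<Longrightarrow> y \<in> C \<Longrightarrow> g x y \<in> C"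
    and "\<And>x y. x \<in> C \<Longrightarrow> y \<in> C \<Longrightarrow> g' (f x) (f y) = f (g x y)"
    and "xs \<noteq> []" "set xs \<subseteq> C"
  shows "fold1 g' (map f xs) = f (fold1 g xs)"
  using assms(3,4)
proof (induction xs)
  case (Cons x xs)
  then show ?case
    using assms(2) fold1_closed[of C g xs] assms(1) by (cases "xs = []") (auto simp: fold1_Cons)
qed simp

lemma term_val_copy:
  assumes f: "inj_on f (carrier S)" and S: "ai_semiring S"
    and h: "\<And>i. h i \<in> carrier S" and T: "T \<in> terms"
  shows "term_val (copy f S) (f \<circ> h) T = f (term_val S h T)"
proof (rule term_enumeration[OF S h T])
  fix ws assume ws: "set ws = T" "ws \<noteq> []" "[] \<notin> set ws"
    "set (map (word_val S h) ws) \<subseteq> carrier S"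
    and val: "term_val S h T = fold1 (add S) (map (word_val S h) ws)"
  have w: "word_val (copy f S) (f \<circ> h) w = f (word_val S h w)" if "w \<in> set ws" for w
  proof -
    have "fold1 (mul (copy f S)) (map f (map h w)) = f (fold1 (mul S) (map h w))"
    proof (rule fold1_map[of "carrier S"])
      show "map h w \<noteq> []" using that ws(3) by auto
    qed (use h S copy_simps(3)[OF f] in \<open>auto simp: ai_semiring_def\<close>)
    then show ?thesis by (simp add: word_val_def)
  qed
  have "term_val (copy f S) (f \<circ> h) T = fold1 (add (copy f S)) (map (word_val (copy f S) (f \<circ> h)) ws)"
    using term_val_set[OF ai_semiring_copy[OF f S], of "f \<circ> h" ws] ws h copy_simps(1)[OF f] by auto
  also have "map (word_val (copy f S) (f \<circ> h)) ws = map f (map (word_val S h) ws)"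
    using w by simp
  also have "fold1 (add (copy f S)) \<dots> = f (fold1 (add S) (map (word_val S h) ws))"
    using S ws copy_simps(2)[OF f]
    by (intro fold1_map[of "carrier S"]) (auto simp: ai_semiring_def)
  finally show ?thesis by (simp only: val)
qed

text \<open>The assignments into the copy are exactly the compositions \<open>f \<circ> h\<close>,
  and injectivity of \<open>f\<close> keeps distinct values distinct.\<close>

lemma satisfies_copy:
  assumes f: "inj_on f (carrier S)" and S: "ai_semiring S" and e: "e \<in> identities"
  shows "satisfies (copy f S) e \<longleftrightarrow> satisfies S e"
proof -
  have T: "fst e \<in> terms" "snd e \<in> terms" using e by (auto simp: identities_def)
  have eq: "term_val (copy f S) (f \<circ> h) (fst e) = term_val (copy f S) (f \<circ> h) (snd e) \<longleftrightarrow>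
      term_val S h (fst e) = term_val S h (snd e)" if "\<And>i. h i \<in> carrier S" for h
    using term_val_copy[OF f S that] T term_val_closed[OF S that] inj_on_eq_iff[OF f] by simp
  show ?thesis
  proof
    assume sat: "satisfies (copy f S) e"
    show "satisfies S e"
      unfolding satisfies_def
    proof (intro allI impI)
      fix h :: "nat \<Rightarrow> 'a" assume h: "\<forall>i. h i \<in> carrier S"
      then have "\<forall>i. (f \<circ> h) i \<in> carrier (copy f S)" by (simp add: copy_simps(1)[OF f])
      then show "term_val S h (fst e) = term_val S h (snd e)"
        using sat eq[of h] h unfolding satisfies_def by blast
    qed
  next
    assume sat: "satisfies S e"
    show "satisfies (copy f S) e"
      unfolding satisfies_def
    proof (intro allI impI)
      fix k :: "nat \<Rightarrow> 'b" assume k: "\<forall>i. k i \<in> carrier (copy f S)"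
      define h where "h i = inv_into (carrier S) f (k i)" for i
      have h: "h i \<in> carrier S" for i
        using k inv_into_into[of "k i" f "carrier S"] by (simp add: h_def copy_simps(1)[OF f])
      have "f \<circ> h = k"
        using k f_inv_into_f[of _ f "carrier S"] by (auto simp: h_def copy_simps(1)[OF f])
      then show "term_val (copy f S) k (fst e) = term_val (copy f S) k (snd e)"
        using sat eq[of h] h unfolding satisfies_def by metis
    qed
  qed
qed

lemma models_copy:
  assumes "inj_on f (carrier S)" "ai_semiring S" "E \<subseteq> identities"
  shows "copy f S \<in> models E \<longleftrightarrow> S \<in> models E"
  using assms ai_semiring_copy satisfies_copy unfolding models_def by blast

lemma finite_inj_on:
  assumes "infinite (UNIV :: 'u set)" "finite A"
  obtains f :: "'a \<Rightarrow> 'u" where "inj_on f A"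
proof -
  obtain B :: "'u set" where "finite B" "card B = card A"
    using infinite_arbitrarily_large[OF assms(1)] by blast
  then show ?thesis using that assms(2) finite_same_card_bij by (metis bij_betw_imp_inj_on)
qed

section \<open>Identities of \<open>R6\<close>\<close>

definition occ :: "nat set \<Rightarrow> nat list \<Rightarrow> nat" where
  "occ A w = length (filter (\<lambda>x. x \<in> A) w)"

lemma occ_simps [simp]:
  "occ A [] = 0" "occ A (x # w) = (if x \<in> A then Suc (occ A w) else occ A w)"
  by (auto simp: occ_def)

lemma occ_eq_0: "occ A w = 0 \<longleftrightarrow> set w \<inter> A = {}"
  by (induction w) auto

lemma carrier_R6: "carrier R6 = {1, 2, 3, 4, 5, 6}"
  by (simp add: R6_def)

text \<open>The element 3 is neutral for 1, 2, 3 and 4, the squares of 1 and of 4 are both 2, and 2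
  absorbs every product. So only the number of letters from \<open>A\<close> matters.\<close>

lemma word_val_R6:
  assumes "w \<noteq> []" "c = 1 \<or> c = 4"
  shows "word_val R6 (\<lambda>x. if x \<in> A then c else 3) w =
    (if occ A w = 0 then 3 else if occ A w = 1 then c else 2)"
  using assms(1)
proof (induction w)
  case (Cons x w)
  show ?case
  proof (cases "w = []")
    case True
    then show ?thesis by (simp add: word_val_def)
  next
    case False
    then have "word_val R6 (\<lambda>x. if x \<in> A then c else 3) (x # w) =
        mul R6 (if x \<in> A then c else 3) (word_val R6 (\<lambda>x. if x \<in> A then c else 3) w)"
      by (simp add: word_val_def fold1_Cons)
    then show ?thesis using Cons False assms(2) by (auto simp: R6_def)
  qed
qed simp

lemma R6_minimal:
  assumes "x \<in> carrier R6" "c = 3 \<or> c = 4" "add R6 x c = c"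
  shows "x = c"
  using assms by (auto simp: R6_def)

lemma R6_top: "x \<in> carrier R6 \<Longrightarrow> add R6 2 x = 2"
  by (auto simp: R6_def)

text \<open>Both 3 and 4 are minimal in the order of \<open>R6\<close>, so a sum can have such a
  value only if all its summands have it.\<close>

lemma term_val_R6_minimal:
  assumes h: "\<And>i. h i \<in> carrier R6" and T: "T \<in> terms" and c: "c = 3 \<or> c = 4"
  shows "term_val R6 h T = c \<longleftrightarrow> (\<forall>w\<in>T. word_val R6 h w = c)"
proof
  assume l: "term_val R6 h T = c"
  show "\<forall>w\<in>T. word_val R6 h w = c"
  proof
    fix w assume "w \<in> T"
    then have "add R6 (word_val R6 h w) c = c" "w \<noteq> []"
      using term_val_upper[of R6 h T w, OF ai_semiring_R6 h T] T l by (auto simp: terms_def)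
    then show "word_val R6 h w = c"
      using R6_minimal[of "word_val R6 h w" c] word_val_closed[of R6 h w, OF ai_semiring_R6 h] c by simp
  qed
next
  assume r: "\<forall>w\<in>T. word_val R6 h w = c"
  have "add R6 c c = c" "c \<in> carrier R6" using c by (auto simp: R6_def)
  then have "add R6 (term_val R6 h T) c = c"
    using r by (intro term_val_least[of R6 h, OF ai_semiring_R6 h T]) auto
  then show "term_val R6 h T = c"
    using R6_minimal[of "term_val R6 h T" c] term_val_closed[of R6 h T, OF ai_semiring_R6 h T] c by simp
qed

text \<open>The word values are 1, 2 or 3. Sums of 1 and 3 stay below 1, whereas 2 is the greatest
  element and dominates any sum in which it occurs.\<close>

lemma term_val_R6_top:
  assumes T: "T \<in> terms"
  shows "term_val R6 (\<lambda>x. if x \<in> A then 1 else 3) T = 2 \<longleftrightarrow> (\<exists>w\<in>T. occ A w \<ge> 2)"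
    (is "term_val R6 ?h T = 2 \<longleftrightarrow> _")
proof
  have h: "?h i \<in> carrier R6" for i by (simp add: carrier_R6)
  show "\<exists>w\<in>T. occ A w \<ge> 2" if l: "term_val R6 ?h T = 2"
  proof (rule ccontr)
    assume "\<not> ?thesis"
    then have small: "occ A w < 2" "w \<noteq> []" if "w \<in> T" for w
      using that T by (auto simp: terms_def)
    have "add R6 1 1 = 1" "add R6 3 1 = 1" "1 \<in> carrier R6" by (simp_all add: R6_def)
    moreover have "word_val R6 ?h w = 1 \<or> word_val R6 ?h w = 3" if "w \<in> T" for w
      using word_val_R6[of w 1 A] small[OF that] by auto
    then have "add R6 (word_val R6 ?h w) 1 = 1" if "w \<in> T" for w
      using that \<open>add R6 1 1 = 1\<close> \<open>add R6 3 1 = 1\<close> by fastforce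
    ultimately have "add R6 (term_val R6 ?h T) 1 = 1"
      using term_val_least[of R6 ?h, OF ai_semiring_R6 h T] by blast
    then show False using l by (simp add: R6_def)
  qed
  assume "\<exists>w\<in>T. occ A w \<ge> 2"
  then obtain w where w: "w \<in> T" "occ A w \<ge> 2" by blast
  then have "word_val R6 ?h w = 2"
    using word_val_R6[of w 1 A] T by (auto simp: terms_def)
  then have "add R6 2 (term_val R6 ?h T) = term_val R6 ?h T"
    using term_val_upper[of R6 ?h, OF ai_semiring_R6 h T w(1)] by simp
  then show "term_val R6 ?h T = 2"
    using R6_top term_val_closed[of R6 ?h, OF ai_semiring_R6 h T] by metis
qed

section \<open>Combinatorial properties preserved by identities of \<open>R6\<close>\<close>

lemma satisfies_R6_le_1:
  assumes "satisfies R6 (s, t)" "s \<in> terms" "t \<in> terms" "\<And>w. w \<in> s \<Longrightarrow> occ A w \<le> 1" "w \<in> t"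
  shows "occ A w \<le> 1"
proof (rule ccontr)
  let ?h = "\<lambda>x. if x \<in> A then 1 else 3 :: nat"
  assume "\<not> occ A w \<le> 1"
  then have "occ A w \<ge> 2" by simp
  then have "term_val R6 ?h t = 2" using term_val_R6_top[OF assms(3)] assms(5) by blast
  moreover have "term_val R6 ?h s = term_val R6 ?h t"
    using assms(1) by (simp add: satisfies_def carrier_R6)
  ultimately obtain v where "v \<in> s" "occ A v \<ge> 2" using term_val_R6_top[OF assms(2), of A] by auto
  then show False using assms(4)[of v] by simp
qed

text \<open>Evaluating the letters of \<open>A\<close> at 4 and all others at 3 gives every word of
  \<open>s\<close> the same minimal value, which \<open>t\<close> must then share. The case
  \<open>k = 0\<close> controls which letters occur; the case \<open>k = 1\<close> transfers
  2-colourings.\<close>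

lemma satisfies_R6_uniform:
  assumes "satisfies R6 (s, t)" "s \<in> terms" "t \<in> terms"
    and "k \<le> 1" "\<And>w. w \<in> s \<Longrightarrow> occ A w = k" "w \<in> t"
  shows "occ A w = k"
proof -
  define h :: "nat \<Rightarrow> nat" where "h = (\<lambda>x. if x \<in> A then 4 else 3)"
  \<comment> \<open>The common value of the words of \<open>s\<close>: 3 without a letter from
    \<open>A\<close>, 4 with exactly one.\<close>
  define c :: nat where "c = 3 + k"
  have h: "h i \<in> carrier R6" for i by (simp add: carrier_R6 h_def)
  have c: "c = 3 \<or> c = 4" using assms(4) by (auto simp: c_def)
  have iff: "word_val R6 h v = c \<longleftrightarrow> occ A v = k" if "v \<in> s \<union> t" for v
  proof -
    have "v \<noteq> []" using that assms(2,3) by (auto simp: terms_def)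
    then have "word_val R6 h v = (if occ A v = 0 then 3 else if occ A v = 1 then 4 else 2)"
      unfolding h_def by (rule word_val_R6) simp
    moreover have "k = 0 \<or> k = 1" using assms(4) by auto
    ultimately show ?thesis by (auto simp: c_def)
  qed
  have "\<forall>v\<in>s. word_val R6 h v = c" using iff assms(5) by simp
  then have "term_val R6 h s = c"
    using term_val_R6_minimal[of h s c, OF h assms(2) c] by simp
  then have "term_val R6 h t = c"
    using assms(1) h by (simp add: satisfies_def)
  then have "word_val R6 h w = c"
    using term_val_R6_minimal[of h t c, OF h assms(3) c] assms(6) by simp
  then show ?thesis using iff assms(6) by simp
qed

lemma satisfies_sym: "satisfies S (s, t) \<Longrightarrow> satisfies S (t, s)"
  by (auto simp: satisfies_def)

lemma satisfies_R6_content: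
  assumes "satisfies R6 (s, t)" "s \<in> terms" "t \<in> terms"
  shows "\<Union> (set ` t) \<subseteq> \<Union> (set ` s)"
proof
  fix x assume "x \<in> \<Union> (set ` t)"
  then obtain w where w: "w \<in> t" "x \<in> set w" by blast
  then have "occ {x} w \<noteq> 0" by (simp add: occ_eq_0)
  then obtain v where "v \<in> s" "occ {x} v \<noteq> 0"
    using satisfies_R6_uniform[OF assms, of 0 "{x}" w] w(1) by auto
  then show "x \<in> \<Union> (set ` s)" by (auto simp: occ_eq_0)
qed

text \<open>With \<open>A = set w\<close>, each one-letter word of \<open>s\<close> has at most one
  letter in \<open>A\<close>. The same bound for \<open>w\<close> leaves it a single letter, and the
  letters of \<open>t\<close> occur in \<open>s\<close>.\<close>

lemma satisfies_R6_letters_subset: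
  assumes "satisfies R6 (s, t)" "s \<in> terms" "t \<in> terms" "\<And>w. w \<in> s \<Longrightarrow> length w = 1"
  shows "t \<subseteq> s"
proof
  fix w assume w: "w \<in> t"
  then have "w \<noteq> []" using assms(3) by (auto simp: terms_def)
  have "occ (set w) v \<le> 1" if "v \<in> s" for v
    using assms(4)[OF that] length_filter_le[of "\<lambda>x. x \<in> set w" v] by (simp add: occ_def)
  then have "occ (set w) w \<le> 1"
    using satisfies_R6_le_1[OF assms(1-3), of "set w" w] w by blast
  then have "length w \<le> 1" by (simp add: occ_def filter_True)
  then obtain a where a: "w = [a]" using \<open>w \<noteq> []\<close> by (cases w) auto
  then have "a \<in> \<Union> (set ` t)" using w by force
  then obtain v where v: "v \<in> s" "a \<in> set v" using satisfies_R6_content[OF assms(1-3)] by blast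
  then have "v = [a]" using assms(4)[OF v(1)] by (auto simp: length_Suc_conv)
  then show "w \<in> s" using a v by simp
qed

lemma satisfies_R6_letters:
  assumes "satisfies R6 (s, t)" "s \<in> terms" "t \<in> terms" "\<And>w. w \<in> s \<Longrightarrow> length w = 1"
  shows "t = s"
  using satisfies_R6_letters_subset[OF assms]
    satisfies_R6_letters_subset[OF satisfies_sym[OF assms(1)] assms(3,2)] assms(4) by blast

text \<open>By \<open>satisfies_R6_le_1\<close>, some word of \<open>s\<close> also has two letters
  from the set of \<open>a\<close> and \<open>b\<close>. Among square-free words of length at most
  two, only \<open>[a, b]\<close> and \<open>[b, a]\<close> qualify.\<close>

lemma satisfies_R6_pair:
  assumes st: "satisfies R6 (s, t)" "s \<in> terms" "t \<in> terms"
    and short: "\<And>w. w \<in> s \<Longrightarrow> length w \<le> 2" and loop: "\<And>a. [a, a] \<notin> s"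
    and w: "w \<in> t" "occ {a, b} w \<ge> 2"
  shows "[a, b] \<in> s \<or> [b, a] \<in> s"
proof -
  obtain v where v: "v \<in> s" "occ {a, b} v \<ge> 2"
  proof (rule ccontr)
    assume "\<not> thesis"
    then have "occ {a, b} v \<le> 1" if "v \<in> s" for v
      using \<open>\<And>v. v \<in> s \<Longrightarrow> occ {a, b} v \<ge> 2 \<Longrightarrow> thesis\<close> that by (cases "occ {a, b} v \<ge> 2") auto
    then show False using satisfies_R6_le_1[OF st _ w(1), of "{a, b}"] w(2) by simp
  qed
  have "length v \<le> 2" using short[OF v(1)] .
  then consider "v = []" | c where "v = [c]" | c d where "v = [c, d]"
    by (cases v rule: remdups_adj.cases) auto
  then show ?thesis
    using v loop by cases (auto split: if_splits)
qed

section \<open>Graph algebras\<close>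

datatype elt = Letters "nat set" | Edge | Top

fun elt_add :: "nat set \<Rightarrow> elt \<Rightarrow> elt \<Rightarrow> elt" where
  "elt_add D (Letters P) (Letters Q) = Letters (P \<union> Q)"
| "elt_add D (Letters P) Edge = (if P \<subseteq> D then Edge else Top)"
| "elt_add D Edge (Letters P) = (if P \<subseteq> D then Edge else Top)"
| "elt_add D Edge Edge = Edge"
| "elt_add D _ _ = Top"

fun elt_mul :: "(nat \<times> nat) set \<Rightarrow> elt \<Rightarrow> elt \<Rightarrow> elt" where
  "elt_mul r (Letters P) (Letters Q) = (if P \<times> Q \<subseteq> r then Edge else Top)"
| "elt_mul r _ _ = Top"

text \<open>Sets of words modulo the language consisting of the words \<open>ij\<close> with \<open>(i, j) \<in> r\<close> and of
  the letters in \<open>D\<close>: \<open>Letters P\<close> is a set of letters, \<open>Edge\<close> any other subset of the language,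
  and \<open>Top\<close> everything else.\<close>

definition graph_alg :: "nat set \<Rightarrow> (nat \<times> nat) set \<Rightarrow> nat set \<Rightarrow> elt alg" where
  "graph_alg V r D = \<lparr>carrier = Letters ` {P. P \<noteq> {} \<and> P \<subseteq> V} \<union> {Edge, Top},
     add = elt_add D, mul = elt_mul r\<rparr>"

lemma elt_add_laws:
  "elt_add D x x = x"
  "elt_add D x y = elt_add D y x"
  "elt_add D (elt_add D x y) z = elt_add D x (elt_add D y z)"
  by (cases x; cases y; cases z; auto)+

lemma elt_mul_laws:
  "elt_mul r (elt_mul r x y) z = elt_mul r x (elt_mul r y z)"
  "elt_mul r x (elt_add D y z) = elt_add D (elt_mul r x y) (elt_mul r x z)"
  "elt_mul r (elt_add D x y) z = elt_add D (elt_mul r x z) (elt_mul r y z)"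
  by (cases x; cases y; cases z; auto)+

lemma ai_semiring_graph_alg: "ai_semiring (graph_alg V r D)"
proof -
  have "elt_add D x y \<in> carrier (graph_alg V r D)" "elt_mul r x y \<in> carrier (graph_alg V r D)"
    if "x \<in> carrier (graph_alg V r D)" "y \<in> carrier (graph_alg V r D)" for x y
    using that by (auto simp: graph_alg_def split: if_splits)
  moreover have "carrier (graph_alg V r D) \<noteq> {}" by (simp add: graph_alg_def)
  moreover have "add (graph_alg V r D) = elt_add D" "mul (graph_alg V r D) = elt_mul r"
    by (simp_all add: graph_alg_def)
  ultimately show ?thesis
    unfolding ai_semiring_def
    by (auto simp only: elt_add_laws(1,3) elt_mul_laws intro: elt_add_laws(2))
qed

lemma finite_carrier_graph_alg: "finite V \<Longrightarrow> finite (carrier (graph_alg V r D))"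
  by (simp add: graph_alg_def)

text \<open>The value of a word uses multiplication only, which depends on \<open>r\<close> alone;
  the empty sets are fillers for \<open>V\<close> and \<open>D\<close>.\<close>

definition word_elt :: "(nat \<times> nat) set \<Rightarrow> (nat \<Rightarrow> elt) \<Rightarrow> nat list \<Rightarrow> elt" where
  "word_elt r h w = word_val (graph_alg {} r {}) h w"

lemma word_val_graph_alg: "word_val (graph_alg V r D) h w = word_elt r h w"
  by (simp add: word_elt_def word_val_def graph_alg_def)

lemma elt_mul_cases: "elt_mul r x y = Edge \<or> elt_mul r x y = Top"
  by (cases x; cases y; auto)

lemma elt_mul_mul: "elt_mul r x (elt_mul r y z) = Top"
  using elt_mul_cases[of r y z] by (cases x) auto

lemma word_elt_simps:
  "word_elt r h [x] = h x"
  "word_elt r h [x, y] = elt_mul r (h x) (h y)"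
  "word_elt r h (x # y # z # w) = Top"
proof -
  show "word_elt r h [x] = h x" "word_elt r h [x, y] = elt_mul r (h x) (h y)"
    by (simp_all add: word_elt_def word_val_def graph_alg_def)
  show "word_elt r h (x # y # z # w) = Top"
    by (cases w) (simp_all add: word_elt_def word_val_def graph_alg_def elt_mul_mul)
qed

lemma word_cases:
  assumes "w \<noteq> []"
  obtains x where "w = [x]" | x y where "w = [x, y]" | x y z v where "w = x # y # z # v"
  using assms by (metis list.exhaust)

definition below_Edge :: "nat set \<Rightarrow> elt \<Rightarrow> bool" where
  "below_Edge D x \<longleftrightarrow> x = Edge \<or> (\<exists>P\<subseteq>D. x = Letters P)"

lemma below_Edge_iff: "below_Edge D x \<longleftrightarrow> elt_add D x Edge = Edge"
  by (cases x) (auto simp: below_Edge_def)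

text \<open>The colour of \<open>a\<close> can be prescribed because components that avoid \<open>D\<close> can be recoloured.\<close>

definition locally_colourable :: "nat set \<Rightarrow> (nat \<times> nat) set \<Rightarrow> nat set \<Rightarrow> nat \<Rightarrow> bool" where
  "locally_colourable V r D n \<longleftrightarrow> (\<forall>W\<subseteq>V. card W < n \<longrightarrow> (\<forall>a\<in>V - D. \<exists>col.
     (\<forall>i\<in>W. \<forall>j\<in>W. (i, j) \<in> r \<longrightarrow> col i \<noteq> col j) \<and> (\<forall>i\<in>W \<inter> D. col i) \<and> \<not> col a))"

text \<open>Representative vertices turn the variables of \<open>s\<close> into a graph on fewer
  than \<open>n\<close> vertices. Its 2-colourings pull back to sets of variables meeting every word
  of \<open>s\<close>, hence every word of \<open>t\<close>, exactly once. This bounds the length of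
  the words of \<open>t\<close> and controls its one-letter words; two-letter words come from
  \<open>s\<close> up to reversal.\<close>

lemma below_Edge_transfer:
  assumes sat: "satisfies R6 (s, t)" and st: "s \<in> terms" "t \<in> terms"
    and h: "\<And>i. h i \<in> carrier (graph_alg V r D)"
    and loc: "locally_colourable V r D n" "sym r" "V - D \<noteq> {}"
    and small: "card (\<Union> (set ` s)) < n"
    and below: "\<And>w. w \<in> s \<Longrightarrow> below_Edge D (word_elt r h w)"
    and t: "w \<in> t"
  shows "below_Edge D (word_elt r h w)"
proof -
  \<comment> \<open>Each set of letters is represented by a vertex outside \<open>D\<close> whenever
    it has one, so a representative in \<open>D\<close> shows that the whole set lies in
    \<open>D\<close>.\<close>
  have "\<forall>x. \<exists>i. \<forall>P. h x = Letters P \<longrightarrow> i \<in> P \<and> i \<in> V \<and> (P \<subseteq> D \<or> i \<notin> D)"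
  proof
    fix x show "\<exists>i. \<forall>P. h x = Letters P \<longrightarrow> i \<in> P \<and> i \<in> V \<and> (P \<subseteq> D \<or> i \<notin> D)"
      using h[of x] by (cases "h x") (auto simp: graph_alg_def)
  qed
  then obtain rep where rep: "\<And>x P. h x = Letters P \<Longrightarrow>
      rep x \<in> P \<and> rep x \<in> V \<and> (P \<subseteq> D \<or> rep x \<notin> D)"
    by metis
  let ?C = "\<Union> (set ` s)"
  have finC: "finite ?C" using st(1) by (auto simp: terms_def)
  define W where "W = rep ` {x \<in> ?C. \<exists>P. h x = Letters P}"
  have W: "W \<subseteq> V" using rep by (auto simp: W_def)
  have "card W \<le> card {x \<in> ?C. \<exists>P. h x = Letters P}"
    unfolding W_def using finC by (intro card_image_le finite_subset[OF _ finC]) blast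
  also have "\<dots> \<le> card ?C" using finC by (intro card_mono) auto
  finally have cardW: "card W < n" using small by simp

  \<comment> \<open>A product of two elements is \<open>Edge\<close> only for two completely joined
    sets of letters, and longer products are \<open>Top\<close>.\<close>
  have s_cases: "(\<exists>x. v = [x] \<and> below_Edge D (h x)) \<or>
      (\<exists>x y P Q. v = [x, y] \<and> h x = Letters P \<and> h y = Letters Q \<and> P \<times> Q \<subseteq> r)"
    if v: "v \<in> s" for v
  proof -
    have "v \<noteq> []" using st(1) v by (auto simp: terms_def)
    then show ?thesis
    proof (cases rule: word_cases)
      case (1 x)
      then show ?thesis using below[OF v] by (simp add: word_elt_simps)
    next
      case (2 x y)
      then have "elt_mul r (h x) (h y) = Edge"
        using below[OF v] elt_mul_cases[of r "h x" "h y"] by (auto simp: word_elt_simps below_Edge_def)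
      then show ?thesis using 2 by (cases "h x"; cases "h y") (auto split: if_splits)
    next
      case (3 x y z u)
      then show ?thesis using below[OF v] by (simp add: word_elt_simps below_Edge_def)
    qed
  qed

  have colour: "\<exists>Z. (\<forall>v\<in>s \<union> t. occ Z v = 1) \<and> (\<forall>x P. h x = Letters P \<longrightarrow> rep x = a \<longrightarrow> x \<notin> Z)"
    if a: "a \<in> V - D" for a
  proof -
    obtain col where col: "\<And>i j. i \<in> W \<Longrightarrow> j \<in> W \<Longrightarrow> (i, j) \<in> r \<Longrightarrow> col i \<noteq> col j"
      "\<And>i. i \<in> W \<Longrightarrow> i \<in> D \<Longrightarrow> col i" "\<not> col a"
      using loc(1) W cardW a unfolding locally_colourable_def by (metis IntI)
    \<comment> \<open>A variable whose value is not a set of letters is put into \<open>Z\<close>: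
      in \<open>s\<close> it can occur only as a one-letter word of value
      \<open>Edge\<close>.\<close>
    define Z where "Z = {x. (\<exists>P. h x = Letters P) \<longrightarrow> col (rep x)}"
    have Z: "x \<in> Z \<longleftrightarrow> col (rep x)" if "h x = Letters P" for x P
      using that by (auto simp: Z_def)
    have inW: "rep x \<in> W" if "v \<in> s" "x \<in> set v" "h x = Letters P" for x v P
      using that by (auto simp: W_def)
    \<comment> \<open>In a one-letter word of \<open>s\<close> whose value is a set of letters, the
      representative lies in \<open>D\<close> and is therefore coloured; in a two-letter word the
      representatives are adjacent, so exactly one is.\<close>
    have occ_s: "occ Z v = 1" if v: "v \<in> s" for v
      using s_cases[OF v]
    proof (elim disjE exE conjE)
      fix x assume x: "v = [x]" "below_Edge D (h x)"
      have "x \<in> Z"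
      proof (cases "h x = Edge")
        case True
        then show ?thesis by (simp add: Z_def)
      next
        case False
        then obtain P where P: "P \<subseteq> D" "h x = Letters P" using x by (auto simp: below_Edge_def)
        then have "col (rep x)" using rep[OF P(2)] col(2) inW[OF v _ P(2)] x(1) by auto
        then show ?thesis using Z P by blast
      qed
      then show ?thesis using x by simp
    next
      fix x y P Q assume xy: "v = [x, y]" "h x = Letters P" "h y = Letters Q" "P \<times> Q \<subseteq> r"
      then have "(rep x, rep y) \<in> r" using rep[OF xy(2)] rep[OF xy(3)] by blast
      then have "col (rep x) \<noteq> col (rep y)"
        using col(1) inW[OF v _ xy(2)] inW[OF v _ xy(3)] xy(1) by simp
      then show ?thesis using Z[OF xy(2)] Z[OF xy(3)] xy(1) by simp
    qed
    moreover have "occ Z v = 1" if "v \<in> t" for v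
      using satisfies_R6_uniform[OF sat st, of 1 Z v] occ_s that by simp
    moreover have "x \<notin> Z" if "h x = Letters P" "rep x = a" for x P
      using Z that col(3) by blast
    ultimately show ?thesis by blast
  qed
  obtain a where "a \<in> V - D" using loc(3) by blast
  then obtain Z where Z: "\<And>v. v \<in> s \<Longrightarrow> occ Z v = 1" using colour by blast
  \<comment> \<open>A square meets \<open>Z\<close> in zero or two letters, never in one.\<close>
  have loop: "[x, x] \<notin> s" for x using Z[of "[x, x]"] by (auto split: if_splits)
  have length: "length v \<le> 2" if "v \<in> s" for v using s_cases[OF that] by auto
  note pair = satisfies_R6_pair[OF sat st length loop t]

  have "w \<noteq> []" using st(2) t by (auto simp: terms_def)
  then show ?thesis
  proof (cases rule: word_cases)
    case (1 x)
    then have "x \<in> ?C" using satisfies_R6_content[OF sat st] t by force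
    then obtain v where v: "v \<in> s" "x \<in> set v" by blast
    show ?thesis
    proof (cases "h x")
      case (Letters P)
      \<comment> \<open>Otherwise the representative of \<open>x\<close> lies outside
        \<open>D\<close>, and a colouring that leaves it uncoloured gives a set missing the
        one-letter word \<open>w\<close>.\<close>
      have "P \<subseteq> D"
      proof (rule ccontr)
        assume "\<not> P \<subseteq> D"
        then have "rep x \<in> V - D" using rep[OF Letters] by blast
        then obtain Z' where "occ Z' w = 1" "x \<notin> Z'" using colour t Letters by blast
        then show False using 1 by simp
      qed
      then show ?thesis using 1 Letters by (auto simp: word_elt_simps below_Edge_def)
    next
      case Edge
      then show ?thesis using 1 by (simp add: word_elt_simps below_Edge_def)
    next
      case Top
      then show ?thesis using s_cases[OF v(1)] v(2) by (auto simp: below_Edge_def)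
    qed
  next
    case (2 x y)
    then have "[x, y] \<in> s \<or> [y, x] \<in> s" using pair[of x y] by simp
    then have "elt_mul r (h x) (h y) = Edge"
    proof
      assume "[x, y] \<in> s"
      from s_cases[OF this] show ?thesis by auto
    next
      assume "[y, x] \<in> s"
      from s_cases[OF this] obtain P Q where PQ: "h y = Letters P" "h x = Letters Q" "P \<times> Q \<subseteq> r"
        by auto
      then have "Q \<times> P \<subseteq> r" using \<open>sym r\<close> by (auto dest: symD)
      then show ?thesis using PQ by simp
    qed
    then show ?thesis using 2 by (simp add: word_elt_simps below_Edge_def)
  next
    case (3 x y z v)
    \<comment> \<open>The first three letters would form a triangle of two-letter words in
      \<open>s\<close>, which \<open>Z\<close> cannot 2-colour. Equal letters are covered, since
      they would give a loop.\<close>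
    have "[x, y] \<in> s \<or> [y, x] \<in> s" "[y, z] \<in> s \<or> [z, y] \<in> s" "[x, z] \<in> s \<or> [z, x] \<in> s"
      using 3 pair[of x y] pair[of y z] pair[of x z] by simp_all
    moreover have "(p \<in> Z) \<noteq> (q \<in> Z)" if "[p, q] \<in> s \<or> [q, p] \<in> s" for p q
      using that Z[of "[p, q]"] Z[of "[q, p]"] by (auto split: if_splits)
    ultimately show ?thesis by blast
  qed
qed

text \<open>A product is never a set of letters, and adding anything to \<open>Edge\<close> or
  \<open>Top\<close> leaves it among these two.\<close>

lemma term_val_Edge_or_Top:
  assumes h: "\<And>i. h i \<in> carrier (graph_alg V r D)" and T: "T \<in> terms"
    and w: "w \<in> T" "length w \<noteq> 1"
  shows "term_val (graph_alg V r D) h T = Edge \<or> term_val (graph_alg V r D) h T = Top"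
proof -
  have "w \<noteq> []" using w T by (auto simp: terms_def)
  then have "word_elt r h w = Edge \<or> word_elt r h w = Top"
    using w(2) elt_mul_cases by (cases rule: word_cases) (auto simp: word_elt_simps)
  moreover have "elt_add D (word_elt r h w) (term_val (graph_alg V r D) h T) =
      term_val (graph_alg V r D) h T"
    using term_val_upper[of "graph_alg V r D" h T w, OF ai_semiring_graph_alg h T w(1)]
    by (simp only: word_val_graph_alg) (simp add: graph_alg_def)
  ultimately show ?thesis
    by (cases "term_val (graph_alg V r D) h T") (auto split: if_splits)
qed

lemma term_val_below_Edge:
  assumes h: "\<And>i. h i \<in> carrier (graph_alg V r D)" and T: "T \<in> terms"
  shows "below_Edge D (term_val (graph_alg V r D) h T) \<longleftrightarrow> (\<forall>w\<in>T. below_Edge D (word_elt r h w))"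
proof -
  let ?S = "graph_alg V r D"
  let ?v = "term_val ?S h T"
  have add: "add ?S = elt_add D" and E: "Edge \<in> carrier ?S" by (simp_all add: graph_alg_def)
  have up: "elt_add D (word_elt r h w) ?v = ?v" if "w \<in> T" for w
    using term_val_upper[of ?S h T w, OF ai_semiring_graph_alg h T that]
    by (simp only: word_val_graph_alg add)
  have least: "elt_add D ?v Edge = Edge" if "\<And>w. w \<in> T \<Longrightarrow> elt_add D (word_elt r h w) Edge = Edge"
    using term_val_least[of ?S h T Edge, OF ai_semiring_graph_alg h T E] that
    by (simp only: word_val_graph_alg add)
  show ?thesis
    unfolding below_Edge_iff
  proof
    assume v: "elt_add D ?v Edge = Edge"
    show "\<forall>w\<in>T. elt_add D (word_elt r h w) Edge = Edge"
      using up v elt_add_laws(3) by metis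
  qed (use least in blast)
qed

text \<open>If one side consists of letters, both sides coincide. Otherwise both values are
  \<open>Edge\<close> or \<open>Top\<close>, which \<open>below_Edge\<close> tells apart, and
  transfer works in both directions.\<close>

lemma graph_alg_satisfies:
  assumes sat: "satisfies R6 (s, t)" and st: "s \<in> terms" "t \<in> terms"
    and loc: "locally_colourable V r D n" "sym r" "V - D \<noteq> {}"
    and small: "card (\<Union> (set ` s)) < n" "card (\<Union> (set ` t)) < n"
  shows "satisfies (graph_alg V r D) (s, t)"
  unfolding satisfies_def fst_conv snd_conv
proof (intro allI impI)
  fix h :: "nat \<Rightarrow> elt" assume "\<forall>i. h i \<in> carrier (graph_alg V r D)"
  then have h: "h i \<in> carrier (graph_alg V r D)" for i by blast
  let ?v = "term_val (graph_alg V r D) h"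
  consider "\<forall>w\<in>s. length w = 1" | "\<forall>w\<in>t. length w = 1"
    | v w where "v \<in> s" "length v \<noteq> 1" "w \<in> t" "length w \<noteq> 1" by blast
  then show "?v s = ?v t"
  proof cases
    case 1
    then show ?thesis using satisfies_R6_letters[OF sat st] by simp
  next
    case 2
    then show ?thesis using satisfies_R6_letters[OF satisfies_sym[OF sat] st(2,1)] by simp
  next
    case (3 v w)
    have "below_Edge D (?v s) \<longleftrightarrow> below_Edge D (?v t)"
      unfolding term_val_below_Edge[of h V r D, OF h st(1)] term_val_below_Edge[of h V r D, OF h st(2)]
      using below_Edge_transfer[of s t h V r D, OF sat st h loc small(1)]
        below_Edge_transfer[of t s h V r D, OF satisfies_sym[OF sat] st(2,1) h loc small(2)]
      by blast
    then show ?thesis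
      using term_val_Edge_or_Top[of h V r D s v, OF h st(1) 3(1,2)]
        term_val_Edge_or_Top[of h V r D t w, OF h st(2) 3(3,4)]
      by (auto simp: below_Edge_def)
  qed
qed

section \<open>Odd cycles\<close>

text \<open>The cycle on \<open>0, \<dots>, n - 1\<close>, together with the isolated edge between \<open>n\<close> and \<open>n + 1\<close>.\<close>

definition cycle :: "nat \<Rightarrow> (nat \<times> nat) set" where
  "cycle n = {(i, j). (Suc i < n \<and> j = Suc i) \<or> (Suc j < n \<and> i = Suc j) \<or>
     (i = n - 1 \<and> j = 0) \<or> (i = 0 \<and> j = n - 1) \<or> (i = n \<and> j = Suc n) \<or> (i = Suc n \<and> j = n)}"

lemma sym_cycle: "sym (cycle n)"
  by (auto simp: sym_def cycle_def)

text \<open>Fewer than \<open>n\<close> vertices miss some vertex \<open>m\<close> of the cycle.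
  What is left of the cycle lies on a path, which has two opposite 2-colourings; the separate edge
  is coloured independently, so that \<open>n\<close> can be coloured whatever \<open>a\<close>
  is.\<close>

lemma cycle_locally_colourable:
  assumes "odd n"
  shows "locally_colourable {..<n + 2} (cycle n) {n} n"
  unfolding locally_colourable_def
proof (intro allI impI ballI)
  fix W a assume W: "W \<subseteq> {..<n + 2}" "card W < n" and a: "a \<in> {..<n + 2} - {n}"
  have "\<not> {..<n} \<subseteq> W"
    using W card_mono[of W "{..<n}"] finite_subset[OF W(1)] by auto
  then obtain m where m: "m < n" "m \<notin> W" by blast
  \<comment> \<open>Parity, flipped from \<open>m\<close> onwards: as \<open>n\<close> is odd, both
    \<open>0\<close> and \<open>n - 1\<close> are even, and the flip makes the closing edge
    bichromatic.\<close>
  define c where "c i \<longleftrightarrow> (even i \<longleftrightarrow> i < m)" for i :: nat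
  have step: "c (Suc i) \<noteq> c i" if "Suc i \<noteq> m" "i \<noteq> m" for i
    using that by (auto simp: c_def)
  have wrap: "c (n - 1) \<noteq> c 0" if "n - 1 \<noteq> m" "0 \<noteq> m"
    using that m assms by (auto simp: c_def)
  \<comment> \<open>Comparison with \<open>c a\<close> picks, on the cycle, the one of the two
    opposite colourings that leaves \<open>a\<close> uncoloured; off the cycle only \<open>n\<close>
    is coloured.\<close>
  let ?col = "\<lambda>i. i < n \<and> c i \<noteq> c a \<or> i = n"
  have "?col i \<noteq> ?col j" if "i \<in> W" "j \<in> W" "(i, j) \<in> cycle n" for i j
  proof -
    have "i \<noteq> m" "j \<noteq> m" "0 < n" using that m assms by (auto simp: odd_pos)
    then show ?thesis using that(3) step[of i] step[of j] wrap by (auto simp: cycle_def)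
  qed
  moreover have "\<forall>i\<in>W \<inter> {n}. ?col i" "\<not> ?col a" using a by auto
  ultimately show "\<exists>col. (\<forall>i\<in>W. \<forall>j\<in>W. (i, j) \<in> cycle n \<longrightarrow> col i \<noteq> col j) \<and>
      (\<forall>i\<in>W \<inter> {n}. col i) \<and> \<not> col a"
    by (intro exI[of _ ?col]) blast
qed

section \<open>The identities separating \<open>R6\<close> from the graph algebras\<close>

definition cycle_term :: "nat \<Rightarrow> trm" where
  "cycle_term n = (\<lambda>i. [i, Suc i]) ` {i. Suc i < n} \<union> {[n - 1, 0], [n], [n, Suc n]}"

lemma cycle_term_terms: "cycle_term n \<in> terms" "insert [0] (cycle_term n) \<in> terms"
proof -
  have "{i. Suc i < n} \<subseteq> {..<n}" by auto
  then have "finite {i. Suc i < n}" using finite_subset by blast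
  then show "cycle_term n \<in> terms" "insert [0] (cycle_term n) \<in> terms"
    by (auto simp: terms_def cycle_term_def)
qed

text \<open>The exceptions are genuine: 3 times 4 is 4 and 6 times 6 is 5, although 3 is not below 4
  and 6 is not below 5.\<close>

lemma R6_factor_le:
  "\<forall>x\<in>carrier R6. \<forall>y\<in>carrier R6. \<forall>c\<in>carrier R6.
     add R6 (mul R6 x y) c = c \<longrightarrow> c \<noteq> 4 \<longrightarrow> c \<noteq> 5 \<longrightarrow> add R6 x c = c"
  unfolding R6_def by code_simp

text \<open>By minimality the product equals 4, and 4 arises only from the factors 3 and 4, in
  either order.\<close>

lemma R6_mul_le_4:
  "\<forall>x\<in>carrier R6. \<forall>y\<in>carrier R6. add R6 (mul R6 x y) 4 = 4 \<longrightarrow> (x = 4 \<longleftrightarrow> y \<noteq> 4)"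
  unfolding R6_def by code_simp

text \<open>Since 5 is minimal, \<open>x\<close> is 5, and 5 times anything is 2, which is not below
  5.\<close>

lemma R6_mul_le_5:
  "\<forall>x\<in>carrier R6. \<forall>y\<in>carrier R6. add R6 x 5 = 5 \<longrightarrow> add R6 (mul R6 x y) 5 \<noteq> 5"
  unfolding R6_def by code_simp

lemma R6_satisfies_cycle:
  assumes n: "odd n" "n > 1"
  shows "satisfies R6 (cycle_term n, insert [0] (cycle_term n))"
  unfolding satisfies_def fst_conv snd_conv
proof (intro allI impI)
  fix h :: "nat \<Rightarrow> nat" assume "\<forall>i. h i \<in> carrier R6"
  then have h: "h i \<in> carrier R6" for i by blast
  define c where "c = term_val R6 h (cycle_term n)"
  define d where "d = term_val R6 h (insert [0] (cycle_term n))"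
  have c: "c \<in> carrier R6" and d: "d \<in> carrier R6"
    using term_val_closed[of R6 h, OF ai_semiring_R6 h] cycle_term_terms by (auto simp: c_def d_def)
  have up: "add R6 (word_val R6 h w) c = c" if "w \<in> cycle_term n" for w
    using term_val_upper[of R6 h, OF ai_semiring_R6 h cycle_term_terms(1) that] by (simp add: c_def)
  have edge: "add R6 (mul R6 (h i) (h j)) c = c" if "[i, j] \<in> cycle_term n" for i j
    using up[OF that] by (simp add: word_val_def)
  have "c \<noteq> 4"
  proof
    assume 4: "c = 4"
    have alt: "h i = 4 \<longleftrightarrow> h j \<noteq> 4" if "[i, j] \<in> cycle_term n" for i j
      using R6_mul_le_4 h edge[OF that] 4 by blast
    \<comment> \<open>The value 4 alternates along the path from \<open>0\<close> to
      \<open>n - 1\<close>. As \<open>n - 1\<close> is even, its two ends agree, against the closing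
      edge.\<close>
    have "h i = 4 \<longleftrightarrow> (even i \<longleftrightarrow> h 0 = 4)" if "i < n" for i
      using that
    proof (induction i)
      case (Suc i)
      then have "[i, Suc i] \<in> cycle_term n" by (auto simp: cycle_term_def)
      then show ?case using alt Suc by auto
    qed simp
    from this[of "n - 1"] have "h (n - 1) = 4 \<longleftrightarrow> h 0 = 4" using n by auto
    moreover have "[n - 1, 0] \<in> cycle_term n" by (simp add: cycle_term_def)
    ultimately show False using alt by blast
  qed
  moreover have "c \<noteq> 5"
  proof
    assume 5: "c = 5"
    \<comment> \<open>The variables \<open>n\<close> and \<open>Suc n\<close> play the roles of y
      and z.\<close>
    have "[n] \<in> cycle_term n" "[n, Suc n] \<in> cycle_term n" by (simp_all add: cycle_term_def)
    then have "add R6 (h n) 5 = 5" "add R6 (mul R6 (h n) (h (Suc n))) 5 = 5"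
      using up[of "[n]"] edge 5 by (auto simp: word_val_def)
    then show False using R6_mul_le_5 h by blast
  qed
  \<comment> \<open>The first edge of the cycle exhibits \<open>h 0\<close> as a left factor of a
    product below \<open>c\<close>.\<close>
  moreover have "add R6 (mul R6 (h 0) (h 1)) c = c"
    using n by (intro edge) (auto simp: cycle_term_def)
  ultimately have h0: "add R6 (h 0) c = c" using R6_factor_le h c by blast
  have "add R6 (word_val R6 h w) c = c" if "w \<in> insert [0] (cycle_term n)" for w
    using that h0 up by (auto simp: word_val_def)
  then have "add R6 d c = c"
    unfolding d_def using term_val_least[of R6 h, OF ai_semiring_R6 h cycle_term_terms(2) c] by blast
  moreover have "add R6 (word_val R6 h w) d = d" if "w \<in> cycle_term n" for w
    unfolding d_def using that
    by (intro term_val_upper[of R6 h, OF ai_semiring_R6 h cycle_term_terms(2)]) simp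
  then have "add R6 c d = d"
    unfolding c_def using term_val_least[of R6 h, OF ai_semiring_R6 h cycle_term_terms(1) d] by blast
  moreover have "add R6 c d = add R6 d c"
    using ai_semiring_R6 c d unfolding ai_semiring_def by blast
  ultimately show "term_val R6 h (cycle_term n) = term_val R6 h (insert [0] (cycle_term n))"
    by (simp add: c_def d_def)
qed

lemma graph_alg_not_satisfies_cycle:
  assumes n: "n > 1"
  shows "\<not> satisfies (graph_alg {..<n + 2} (cycle n) {n}) (cycle_term n, insert [0] (cycle_term n))"
    (is "\<not> satisfies ?S _")
proof
  assume sat: "satisfies ?S (cycle_term n, insert [0] (cycle_term n))"
  define h where "h i = (if i < n + 2 then Letters {i} else Top)" for i
  have h: "h i \<in> carrier ?S" for i by (simp add: h_def graph_alg_def)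
  define c where "c = term_val ?S h (cycle_term n)"
  have "\<forall>w\<in>cycle_term n. below_Edge {n} (word_elt (cycle n) h w)"
    using n by (auto simp: cycle_term_def word_elt_simps h_def below_Edge_def cycle_def)
  then have "below_Edge {n} c"
    using term_val_below_Edge[of h "{..<n + 2}" "cycle n" "{n}", OF h cycle_term_terms(1)]
    by (simp add: c_def)
  moreover have "c = term_val ?S h (insert [0] (cycle_term n))"
    using sat h by (simp add: satisfies_def c_def)
  then have "add ?S (word_val ?S h [0]) c = c"
    using term_val_upper[of ?S h "insert [0] (cycle_term n)" "[0]", OF ai_semiring_graph_alg h
        cycle_term_terms(2)] by simp
  then have "elt_add {n} (Letters {0}) c = c"
    by (simp add: word_val_def h_def graph_alg_def)
  ultimately show False
  proof (cases c)
    case (Letters P)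
    then have "P \<subseteq> {n}" "0 \<in> P"
      using \<open>below_Edge {n} c\<close> \<open>elt_add {n} (Letters {0}) c = c\<close> by (auto simp: below_Edge_def)
    then show False using n by auto
  qed (use n in \<open>auto simp: below_Edge_def\<close>)
qed

theorem corollary3p8:
  assumes "infinite (UNIV :: 'u set)"
  shows "\<not> finitely_based (generated_variety R6 :: 'u alg set)"
proof
  assume "finitely_based (generated_variety R6 :: 'u alg set)"
  then obtain E where E: "finite E" "E \<subseteq> identities"
      "(generated_variety R6 :: 'u alg set) = models E"
    unfolding finitely_based_def by blast
  have "finite (carrier R6)" by (simp add: carrier_R6)
  then obtain f :: "nat \<Rightarrow> 'u" where f: "inj_on f (carrier R6)"
    by (rule finite_inj_on[OF assms])
  \<comment> \<open>The basis \<open>E\<close> is known to define the variety only among algebras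
    over \<open>'u\<close>, so \<open>R6\<close> is tested against it through a copy.\<close>
  have "copy f R6 \<in> generated_variety R6"
    unfolding generated_variety_def using models_copy[OF f ai_semiring_R6] by blast
  then have "R6 \<in> models E" using models_copy[OF f ai_semiring_R6 E(2)] E(3) by simp
  then have R6: "satisfies R6 e" if "e \<in> E" for e using that by (auto simp: models_def)

  define C where "C = (\<Union>(s, t)\<in>E. \<Union> (set ` s) \<union> \<Union> (set ` t))"
  have "finite C"
    using E(1,2) by (auto simp: C_def identities_def terms_def)
  \<comment> \<open>An odd cycle length exceeding the number of variables in the whole basis, hence
    in each side of each of its identities.\<close>
  define n where "n = 2 * card C + 3"
  have n: "odd n" "n > 1" by (simp_all add: n_def)
  let ?S = "graph_alg {..<n + 2} (cycle n) {n}"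
  obtain g :: "elt \<Rightarrow> 'u" where g: "inj_on g (carrier ?S)"
    using finite_inj_on[OF assms finite_carrier_graph_alg] by blast
  have "satisfies ?S (s, t)" if st: "(s, t) \<in> E" for s t
  proof -
    have "\<Union> (set ` s) \<subseteq> C" "\<Union> (set ` t) \<subseteq> C" using st by (auto simp: C_def)
    then have "card (\<Union> (set ` s)) \<le> card C" "card (\<Union> (set ` t)) \<le> card C"
      using \<open>finite C\<close> card_mono by blast+
    then have small: "card (\<Union> (set ` s)) < n" "card (\<Union> (set ` t)) < n" by (simp_all add: n_def)
    have "s \<in> terms" "t \<in> terms" using E(2) st by (auto simp: identities_def)
    moreover have "{..<n + 2} - {n} \<noteq> {}" using n(2) by auto
    ultimately show ?thesis
      using graph_alg_satisfies R6[OF st] cycle_locally_colourable[OF n(1)] sym_cycle small by blast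
  qed
  then have "?S \<in> models E" using ai_semiring_graph_alg by (auto simp: models_def)
  then have "copy g ?S \<in> generated_variety R6"
    using models_copy[OF g ai_semiring_graph_alg E(2)] E(3) by simp
  moreover have id: "{(cycle_term n, insert [0] (cycle_term n))} \<subseteq> identities"
    using cycle_term_terms by (simp add: identities_def)
  moreover have "R6 \<in> models {(cycle_term n, insert [0] (cycle_term n))}"
    using R6_satisfies_cycle[OF n] ai_semiring_R6 by (simp add: models_def)
  \<comment> \<open>The copy satisfies \<open>E\<close> and so lies in the generated variety, where
    every identity of \<open>R6\<close> must hold, in particular the one for the cycle of length
    \<open>n\<close>.\<close>
  ultimately have "copy g ?S \<in> models {(cycle_term n, insert [0] (cycle_term n))}"
    unfolding generated_variety_def by blast
  then have "satisfies ?S (cycle_term n, insert [0] (cycle_term n))"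
    using models_copy[OF g ai_semiring_graph_alg id] by (simp add: models_def)
  then show False using graph_alg_not_satisfies_cycle[OF n(2)] by simp
qed

end
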